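(* Let $T>0$, let $\beta_p,\beta_w,\delta:[0,T]\to(0,\infty)$ be continuous, let $\beta_x,\alpha,\gamma_p,\gamma_w,\gamma_x,r>0$ and $C_0$ be constants, and consider the coupled Riccati system for $(P_2,P_1,P_0,N_2,N_1,N_0)$ with zero terminal values at $t=T$ given in the context. Then the system has a unique local solution: there exists $\eta\in(0,T]$ such that the coupled equations for $(P_2,N_2)$ with $P_2(T)=N_2(T)=0$ have a unique solution on $[T-\eta,T]$; and, given this solution, the equations for $(P_1,N_1)$ with $P_1(T)=N_1(T)=0$, and then those for $(P_0,N_0)$ with $P_0(T)=N_0(T)=0$, have unique solutions on $[T-\eta,T]$.
   Context: **Coefficients** (functions of $t$; put $\kappa=1+\frac{\gamma_p}{2\gamma_w}$): $K_1=-\frac{e^{rt}\gamma_w\beta_w}{\gamma_p(2\gamma_w+\gamma_p)}$, $K_2=\frac{e^{rt}(2\gamma_w\beta_p-\beta_w\gamma_p)}{\gamma_p(2\gamma_w+\gamma_p)}$, $K_3=\frac{(\gamma_w+\gamma_p)\gamma_x}{\gamma_p(2\gamma_w+\gamma_p)}$, $K_4=\frac{(\gamma_w+\gamma_p)\alpha-C_0\gamma_w^2}{\gamma_p(2\gamma_w+\gamma_p)}$, $K_5=\frac{e^{rt}\beta_w-\gamma_pK_1}{2\gamma_w}$, $K_6=-\frac{\gamma_pK_2}{2\gamma_w}$, $K_7=\frac{\gamma_x-\gamma_pK_3}{2\gamma_w}$, $K_8=\frac{\alpha+C_0\gamma_w-\gamma_pK_4}{2\gamma_w}$, $K_9=\beta_pK_1-\frac{\gamma_pK_1\beta_w}{2\gamma_w}+\frac{e^{rt}\beta_w^2}{2\gamma_w}+\frac{e^{rt}\delta^2}2$,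 $K_{10}=\beta_pK_2-\frac{\gamma_pK_2\beta_w}{2\gamma_w}+\frac{e^{rt}\delta^2}2$, $K_{11}=\beta_pK_3-\frac{\gamma_pK_3\beta_w}{2\gamma_w}+\frac{\gamma_x\beta_w}{2\gamma_w}-\beta_x$, $K_{12}=\beta_pK_4-\frac{\gamma_pK_4\beta_w}{2\gamma_w}+\frac{\beta_w(\alpha+C_0\gamma_w)}{2\gamma_w}$, $K_{13}=-\gamma_pK_1-e^{rt}\beta_w$, $K_{14}=\gamma_x-\gamma_pK_3$, $K_{15}=\alpha-C_0\gamma_w-\gamma_pK_4$, $K_{16}=\kappa K_1-\frac{e^{rt}\beta_w}{2\gamma_w}$, $K_{17}=\kappa K_3-\frac{\gamma_x}{2\gamma_w}$, $K_{18}=\kappa K_4-\frac{\alpha+C_0\gamma_w}{2\gamma_w}$. **Riccati system.** With the abbreviations $a=2K_9P_2+2K_{10}N_2+K_{11}$, $b=K_9(P_1+P_2)+K_{10}(N_1+N_2)+K_{12}$, $c=2K_{13}P_2-2\gamma_pK_2N_2+K_{14}$, $d=K_{13}(P_1+P_2)-\gamma_pK_2(N_1+N_2)+K_{15}$, $e_1=2K_5P_2+2K_6N_2+K_7$, $e_0=K_5(P_1+P_2)+K_6(N_1+N_2)+K_8-C_0$, $h_1=2K_{16}P_2+2\kappa K_2N_2+K_{17}$, $h_0=K_{16}(P_1+P_2)+\kappa K_2(N_1+N_2)+K_{18}$, the system is $$\dot P_2+2P_2a+\tfrac{e^{-rt}}2e_1c-e^{rt}\delta^2P_2^2=0,$$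 $$\dot N_2+2N_2a+\tfrac{e^{-rt}}2h_1c-e^{rt}\delta^2N_2^2=0,$$ $$\dot P_1+2P_2b+P_1a+P_2(a+2\beta_x)+\tfrac{e^{-rt}}2(e_1d+e_0c)-e^{rt}\delta^2P_2(P_1+P_2)=0,$$ $$\dot N_1+2N_2b+N_1a+N_2(a+2\beta_x)+\tfrac{e^{-rt}}2(h_1d+h_0c)-e^{rt}\delta^2N_2(N_1+N_2)=0,$$ $$\dot P_0+(P_1+P_2)b+\tfrac{e^{-rt}}2e_0d-\tfrac{e^{rt}\delta^2}4(P_1+P_2)^2=0,$$ $$\dot N_0+(N_1+N_2)b+\tfrac{e^{-rt}}2h_0d-\tfrac{e^{rt}\delta^2}4(N_1+N_2)^2=0,$$ with $P_2(T)=P_1(T)=P_0(T)=N_2(T)=N_1(T)=N_0(T)=0$. Solutions are continuously differentiable functions. *)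

theory Defs
  imports "HOL-Analysis.Analysis"
begin

record model =
  beta_p :: "real \<Rightarrow> real"
  beta_w :: "real \<Rightarrow> real"
  delta :: "real \<Rightarrow> real"
  beta_x :: real
  alpha :: real
  gamma_p :: real
  gamma_w :: real
  gamma_x :: real
  rate :: real
  C0 :: real

definition kappa :: "model \<Rightarrow> real" where
  "kappa M = 1 + gamma_p M / (2 * gamma_w M)"

definition ert :: "model \<Rightarrow> real \<Rightarrow> real" where
  "ert M t = exp (rate M * t)"

definition K1 :: "model \<Rightarrow> real \<Rightarrow> real" where
  "K1 M t = - (ert M t * gamma_w M * beta_w M t) / (gamma_p M * (2 * gamma_w M + gamma_p M))"

definition K2 :: "model \<Rightarrow> real \<Rightarrow> real" where
  "K2 M t = ert M t * (2 * gamma_w M * beta_p M t - beta_w M t * gamma_p M)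
     / (gamma_p M * (2 * gamma_w M + gamma_p M))"

definition K3 :: "model \<Rightarrow> real" where
  "K3 M = (gamma_w M + gamma_p M) * gamma_x M / (gamma_p M * (2 * gamma_w M + gamma_p M))"

definition K4 :: "model \<Rightarrow> real" where
  "K4 M = ((gamma_w M + gamma_p M) * alpha M - C0 M * (gamma_w M)\<^sup>2)
     / (gamma_p M * (2 * gamma_w M + gamma_p M))"

definition K5 :: "model \<Rightarrow> real \<Rightarrow> real" where
  "K5 M t = (ert M t * beta_w M t - gamma_p M * K1 M t) / (2 * gamma_w M)"

definition K6 :: "model \<Rightarrow> real \<Rightarrow> real" where
  "K6 M t = - (gamma_p M * K2 M t) / (2 * gamma_w M)"

definition K7 :: "model \<Rightarrow> real" where
  "K7 M = (gamma_x M - gamma_p M * K3 M) / (2 * gamma_w M)"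

definition K8 :: "model \<Rightarrow> real" where
  "K8 M = (alpha M + C0 M * gamma_w M - gamma_p M * K4 M) / (2 * gamma_w M)"

definition K9 :: "model \<Rightarrow> real \<Rightarrow> real" where
  "K9 M t = beta_p M t * K1 M t - gamma_p M * K1 M t * beta_w M t / (2 * gamma_w M)
     + ert M t * (beta_w M t)\<^sup>2 / (2 * gamma_w M) + ert M t * (delta M t)\<^sup>2 / 2"

definition K10 :: "model \<Rightarrow> real \<Rightarrow> real" where
  "K10 M t = beta_p M t * K2 M t - gamma_p M * K2 M t * beta_w M t / (2 * gamma_w M)
     + ert M t * (delta M t)\<^sup>2 / 2"

definition K11 :: "model \<Rightarrow> real \<Rightarrow> real" where
  "K11 M t = beta_p M t * K3 M - gamma_p M * K3 M * beta_w M t / (2 * gamma_w M)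
     + gamma_x M * beta_w M t / (2 * gamma_w M) - beta_x M"

definition K12 :: "model \<Rightarrow> real \<Rightarrow> real" where
  "K12 M t = beta_p M t * K4 M - gamma_p M * K4 M * beta_w M t / (2 * gamma_w M)
     + beta_w M t * (alpha M + C0 M * gamma_w M) / (2 * gamma_w M)"

definition K13 :: "model \<Rightarrow> real \<Rightarrow> real" where
  "K13 M t = - gamma_p M * K1 M t - ert M t * beta_w M t"

definition K14 :: "model \<Rightarrow> real" where
  "K14 M = gamma_x M - gamma_p M * K3 M"

definition K15 :: "model \<Rightarrow> real" where
  "K15 M = alpha M - C0 M * gamma_w M - gamma_p M * K4 M"

definition K16 :: "model \<Rightarrow> real \<Rightarrow> real" where
  "K16 M t = kappa M * K1 M t - ert M t * beta_w M t / (2 * gamma_w M)"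

definition K17 :: "model \<Rightarrow> real" where
  "K17 M = kappa M * K3 M - gamma_x M / (2 * gamma_w M)"

definition K18 :: "model \<Rightarrow> real" where
  "K18 M = kappa M * K4 M - (alpha M + C0 M * gamma_w M) / (2 * gamma_w M)"

text \<open>The abbreviations a, b, c, d, e1, e0, h1, h0 of the system. The arguments p2, n2, p1, n1
  are the values at time t of the unknown functions.\<close>

definition ric_a :: "model \<Rightarrow> real \<Rightarrow> real \<Rightarrow> real \<Rightarrow> real" where
  "ric_a M t p2 n2 = 2 * K9 M t * p2 + 2 * K10 M t * n2 + K11 M t"

definition ric_b :: "model \<Rightarrow> real \<Rightarrow> real \<Rightarrow> real \<Rightarrow> real \<Rightarrow> real \<Rightarrow> real" where
  "ric_b M t p2 n2 p1 n1 = K9 M t * (p1 + p2) + K10 M t * (n1 + n2) + K12 M t"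

definition ric_c :: "model \<Rightarrow> real \<Rightarrow> real \<Rightarrow> real \<Rightarrow> real" where
  "ric_c M t p2 n2 = 2 * K13 M t * p2 - 2 * gamma_p M * K2 M t * n2 + K14 M"

definition ric_d :: "model \<Rightarrow> real \<Rightarrow> real \<Rightarrow> real \<Rightarrow> real \<Rightarrow> real \<Rightarrow> real" where
  "ric_d M t p2 n2 p1 n1 = K13 M t * (p1 + p2) - gamma_p M * K2 M t * (n1 + n2) + K15 M"

definition ric_e1 :: "model \<Rightarrow> real \<Rightarrow> real \<Rightarrow> real \<Rightarrow> real" where
  "ric_e1 M t p2 n2 = 2 * K5 M t * p2 + 2 * K6 M t * n2 + K7 M"

definition ric_e0 :: "model \<Rightarrow> real \<Rightarrow> real \<Rightarrow> real \<Rightarrow> real \<Rightarrow> real \<Rightarrow> real" where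
  "ric_e0 M t p2 n2 p1 n1 = K5 M t * (p1 + p2) + K6 M t * (n1 + n2) + K8 M - C0 M"

definition ric_h1 :: "model \<Rightarrow> real \<Rightarrow> real \<Rightarrow> real \<Rightarrow> real" where
  "ric_h1 M t p2 n2 = 2 * K16 M t * p2 + 2 * kappa M * K2 M t * n2 + K17 M"

definition ric_h0 :: "model \<Rightarrow> real \<Rightarrow> real \<Rightarrow> real \<Rightarrow> real \<Rightarrow> real \<Rightarrow> real" where
  "ric_h0 M t p2 n2 p1 n1 = K16 M t * (p1 + p2) + kappa M * K2 M t * (n1 + n2) + K18 M"

text \<open>Derivatives are taken within the interval, hence one-sided at its end points.\<close>

definition has_C1_derivative_on ::
  "(real \<Rightarrow> real) \<Rightarrow> (real \<Rightarrow> real) \<Rightarrow> real set \<Rightarrow> bool" where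
  "has_C1_derivative_on f f' S \<longleftrightarrow>
     (\<forall>t\<in>S. (f has_real_derivative f' t) (at t within S)) \<and> continuous_on S f'"

definition solves_P2_N2 ::
  "model \<Rightarrow> real \<Rightarrow> real \<Rightarrow> (real \<Rightarrow> real) \<Rightarrow> (real \<Rightarrow> real) \<Rightarrow> bool" where
  "solves_P2_N2 M T \<eta> P2 N2 \<longleftrightarrow>
     P2 T = 0 \<and> N2 T = 0 \<and>
     (\<exists>dP2 dN2.
        has_C1_derivative_on P2 dP2 {T - \<eta>..T} \<and>
        has_C1_derivative_on N2 dN2 {T - \<eta>..T} \<and>
        (\<forall>t\<in>{T - \<eta>..T}.
           let a = ric_a M t (P2 t) (N2 t);
               c = ric_c M t (P2 t) (N2 t);
               e1 = ric_e1 M t (P2 t) (N2 t);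
               h1 = ric_h1 M t (P2 t) (N2 t)
           in
             dP2 t + 2 * P2 t * a + exp (- rate M * t) / 2 * e1 * c
               - ert M t * (delta M t)\<^sup>2 * (P2 t)\<^sup>2 = 0 \<and>
             dN2 t + 2 * N2 t * a + exp (- rate M * t) / 2 * h1 * c
               - ert M t * (delta M t)\<^sup>2 * (N2 t)\<^sup>2 = 0))"

definition solves_P1_N1 ::
  "model \<Rightarrow> real \<Rightarrow> real \<Rightarrow> (real \<Rightarrow> real) \<Rightarrow> (real \<Rightarrow> real)
     \<Rightarrow> (real \<Rightarrow> real) \<Rightarrow> (real \<Rightarrow> real) \<Rightarrow> bool" where
  "solves_P1_N1 M T \<eta> P2 N2 P1 N1 \<longleftrightarrow>
     P1 T = 0 \<and> N1 T = 0 \<and>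
     (\<exists>dP1 dN1.
        has_C1_derivative_on P1 dP1 {T - \<eta>..T} \<and>
        has_C1_derivative_on N1 dN1 {T - \<eta>..T} \<and>
        (\<forall>t\<in>{T - \<eta>..T}.
           let a = ric_a M t (P2 t) (N2 t);
               b = ric_b M t (P2 t) (N2 t) (P1 t) (N1 t);
               c = ric_c M t (P2 t) (N2 t);
               d = ric_d M t (P2 t) (N2 t) (P1 t) (N1 t);
               e1 = ric_e1 M t (P2 t) (N2 t);
               e0 = ric_e0 M t (P2 t) (N2 t) (P1 t) (N1 t);
               h1 = ric_h1 M t (P2 t) (N2 t);
               h0 = ric_h0 M t (P2 t) (N2 t) (P1 t) (N1 t)
           in
             dP1 t + 2 * P2 t * b + P1 t * a + P2 t * (a + 2 * beta_x M)
               + exp (- rate M * t) / 2 * (e1 * d + e0 * c)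
               - ert M t * (delta M t)\<^sup>2 * P2 t * (P1 t + P2 t) = 0 \<and>
             dN1 t + 2 * N2 t * b + N1 t * a + N2 t * (a + 2 * beta_x M)
               + exp (- rate M * t) / 2 * (h1 * d + h0 * c)
               - ert M t * (delta M t)\<^sup>2 * N2 t * (N1 t + N2 t) = 0))"

definition solves_P0_N0 ::
  "model \<Rightarrow> real \<Rightarrow> real \<Rightarrow> (real \<Rightarrow> real) \<Rightarrow> (real \<Rightarrow> real)
     \<Rightarrow> (real \<Rightarrow> real) \<Rightarrow> (real \<Rightarrow> real)
     \<Rightarrow> (real \<Rightarrow> real) \<Rightarrow> (real \<Rightarrow> real) \<Rightarrow> bool" where
  "solves_P0_N0 M T \<eta> P2 N2 P1 N1 P0 N0 \<longleftrightarrow>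
     P0 T = 0 \<and> N0 T = 0 \<and>
     (\<exists>dP0 dN0.
        has_C1_derivative_on P0 dP0 {T - \<eta>..T} \<and>
        has_C1_derivative_on N0 dN0 {T - \<eta>..T} \<and>
        (\<forall>t\<in>{T - \<eta>..T}.
           let b = ric_b M t (P2 t) (N2 t) (P1 t) (N1 t);
               d = ric_d M t (P2 t) (N2 t) (P1 t) (N1 t);
               e0 = ric_e0 M t (P2 t) (N2 t) (P1 t) (N1 t);
               h0 = ric_h0 M t (P2 t) (N2 t) (P1 t) (N1 t)
           in
             dP0 t + (P1 t + P2 t) * b + exp (- rate M * t) / 2 * e0 * d
               - ert M t * (delta M t)\<^sup>2 / 4 * (P1 t + P2 t)\<^sup>2 = 0 \<and>
             dN0 t + (N1 t + N2 t) * b + exp (- rate M * t) / 2 * h0 * d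
               - ert M t * (delta M t)\<^sup>2 / 4 * (N1 t + N2 t)\<^sup>2 = 0))"

text \<open>Functions on an interval are represented by total functions, so a solution is
  unique up to its values outside the interval.\<close>

definition unique_solution_on ::
  "real set \<Rightarrow> ((real \<Rightarrow> real) \<Rightarrow> (real \<Rightarrow> real) \<Rightarrow> bool)
     \<Rightarrow> (real \<Rightarrow> real) \<Rightarrow> (real \<Rightarrow> real) \<Rightarrow> bool" where
  "unique_solution_on S solves f g \<longleftrightarrow>
     solves f g \<and>
     (\<forall>f' g'. solves f' g' \<longrightarrow> (\<forall>t\<in>S. f' t = f t \<and> g' t = g t))"

end

theory Submission
  imports Defs
begin

text \<open>Each pair of equations is a terminal value problem y' = F(t, y), y(T) = 0 in the plane. For
  F continuous and globally Lipschitz in y, the Picard operator is a contraction for the sup norm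
  weighted by exp(-K (T - t)), so a solution exists on the whole interval. The pair (P1, N1)
  is affine in the unknowns and (P0, N0) is a pure integration, so this applies to both. The quadratic
  field of (P2, N2) is Lipschitz on bounded sets only; composing it with the nearest-point
  projection onto the closed unit ball makes it globally Lipschitz, and by continuity the solution stays in the ball,
  where the projection is the identity, for t close to T. Uniqueness, also among solutions that leave
  the ball, follows from a Gronwall argument, since two solutions on a compact interval are bounded.\<close>

subsection \<open>Terminal value problems\<close>

text \<open>The Lipschitz constant is uniform in time. The state set \<open>Y\<close> is a parameter
  since several choices occur: the whole space and the unit ball around the terminal value for
  existence, balls of every radius for uniqueness.\<close>

definition cont_lipschitz :: "real set \<Rightarrow> 'a::metric_space set \<Rightarrow> (real \<Rightarrow> 'a \<Rightarrow> 'b::metric_space) \<Rightarrow> bool" where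
  "cont_lipschitz S Y F \<longleftrightarrow>
     continuous_on (S \<times> Y) (\<lambda>(t, y). F t y) \<and> (\<exists>L. \<forall>t\<in>S. L-lipschitz_on Y (F t))"

definition terminal_value_solution :: "real set \<Rightarrow> real \<Rightarrow> (real \<Rightarrow> 'a::real_normed_vector \<Rightarrow> 'a) \<Rightarrow> 'a
    \<Rightarrow> (real \<Rightarrow> 'a) \<Rightarrow> bool" where
  "terminal_value_solution S T F y0 y \<longleftrightarrow>
     y T = y0 \<and> (\<forall>t\<in>S. (y has_vector_derivative F t (y t)) (at t within S))"

lemma continuous_on_field_compose:
  assumes "continuous_on (S \<times> Y) (\<lambda>(t, y). F t y)"
    and "continuous_on S y" "y ` S \<subseteq> Y"
  shows "continuous_on S (\<lambda>t. F t (y t))"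
proof -
  have "continuous_on S ((\<lambda>(t, y). F t y) \<circ> (\<lambda>t. (t, y t)))"
    using assms by (intro continuous_on_compose continuous_intros)
      (auto elim!: continuous_on_subset)
  then show ?thesis by (simp add: o_def)
qed

lemma terminal_value_solution_continuous_on:
  "terminal_value_solution S T F y0 y \<Longrightarrow> continuous_on S y"
  unfolding terminal_value_solution_def
  by (meson continuous_on_eq_continuous_within has_vector_derivative_continuous)

text \<open>The factor \<open>1 / K\<close> gained by integrating the weight is what makes the
  Picard operator contract for large \<open>K\<close>.\<close>

lemma integral_exp_backward:
  fixes K :: real
  assumes "K \<noteq> 0" "t \<le> b"
  shows "((\<lambda>s. exp (K * (b - s))) has_integral (exp (K * (b - t)) - 1) / K) {t..b}"
proof -
  have "((\<lambda>s. exp (K * (b - s))) has_integral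
      (- exp (K * (b - b)) / K) - (- exp (K * (b - t)) / K)) {t..b}"
    using assms
    by (intro fundamental_theorem_of_calculus)
      (auto intro!: derivative_eq_intros simp flip: has_real_derivative_iff_has_vector_derivative)
  then show ?thesis using assms by (simp add: field_simps)
qed

text \<open>The weighted norm is realised by a change of unknown: if y(t) = exp(K (b - t)) w(t), the
  plain sup norm of w is the weighted norm of y, and Banach's theorem applies in the complete space
  of bounded continuous functions. No smallness of the interval enters.\<close>

theorem picard_lindelof_global:
  fixes F :: "real \<Rightarrow> 'a::banach \<Rightarrow> 'a"
  assumes ab: "a \<le> b" and F: "cont_lipschitz {a..b} UNIV F"
  shows "\<exists>y. terminal_value_solution {a..b} b F y0 y"
proof -
  let ?S = "{a..b}"
  have contF: "continuous_on (?S \<times> UNIV) (\<lambda>(t, y). F t y)"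
    using F by (auto simp: cont_lipschitz_def)
  obtain L where L: "\<And>t. t \<in> ?S \<Longrightarrow> L-lipschitz_on UNIV (F t)"
    using F unfolding cont_lipschitz_def by blast
  have L0: "L \<ge> 0" using L[of a] ab lipschitz_on_nonneg by auto
  \<comment> \<open>The contraction factor will be \<open>L / K\<close>. This choice bounds it by
    1/2, and the summand 1 keeps \<open>K\<close> positive when \<open>L = 0\<close>.\<close>
  define K where "K = 2 * L + 1"
  have K: "K > 0" using L0 by (simp add: K_def)
  \<comment> \<open>\<open>G w\<close> is the field along the unscaled function, and \<Phi> is the
    Picard operator conjugated with the rescaling. The data sit at the right end point, so the
    integral from \<open>t\<close> to \<open>b\<close> is subtracted.\<close>
  define G where "G w s = F s (exp (K * (b - s)) *\<^sub>R apply_bcontfun w s)"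
    for w :: "real \<Rightarrow>\<^sub>C 'a" and s
  define \<Phi> where "\<Phi> w t = exp (- K * (b - t)) *\<^sub>R (y0 - integral {t..b} (G w))"
    for w :: "real \<Rightarrow>\<^sub>C 'a" and t
  have contG: "continuous_on ?S (G w)" for w
    unfolding G_def by (intro continuous_on_field_compose[OF contF] continuous_intros) auto
  have intG: "G w integrable_on {t..b}" if "t \<in> ?S" for w t
    using that by (intro integrable_continuous_real continuous_on_subset[OF contG]) auto
  have cont\<Phi>: "continuous_on ?S (\<Phi> w)" for w
    unfolding \<Phi>_def
    by (intro continuous_intros indefinite_integral_continuous_1' integrable_continuous_real contG)
  \<comment> \<open>Bounded continuous functions live on the whole real line. Clamping the time to
    the interval extends \<open>\<Phi> w\<close> constantly to both sides, which keeps it continuous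
    and bounded.\<close>
  define c where "c t = max a (min b t)" for t
  have c: "c t \<in> ?S" "t \<in> ?S \<Longrightarrow> c t = t" for t using ab by (auto simp: c_def)
  define A where "A w = Bcontfun (\<lambda>t. \<Phi> w (c t))" for w
  have A: "apply_bcontfun (A w) t = \<Phi> w (c t)" for w t
  proof -
    have "continuous_on UNIV (\<Phi> w \<circ> c)"
      using c by (intro continuous_on_compose continuous_on_subset[OF cont\<Phi>])
        (auto simp: c_def intro!: continuous_intros)
    moreover have "bounded (range (\<lambda>t. \<Phi> w (c t)))"
      using compact_imp_bounded[OF compact_continuous_image[OF cont\<Phi>[of w] compact_Icc]] c(1)
      by (elim bounded_subset) blast
    ultimately show ?thesis
      unfolding A_def by (subst Bcontfun_inverse) (auto simp: bcontfun_def o_def)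
  qed
  have contr: "dist (A w) (A v) \<le> 1/2 * dist w v" for w v
  proof (rule dist_bound)
    fix t
    define \<tau> where "\<tau> = c t"
    have \<tau>: "a \<le> \<tau>" "\<tau> \<le> b" using c[of t] by (auto simp: \<tau>_def)
    have I: "((\<lambda>s. L * dist w v * exp (K * (b - s))) has_integral
        L * dist w v * ((exp (K * (b - \<tau>)) - 1) / K)) {\<tau>..b}"
      using K \<tau> by (intro has_integral_mult_right integral_exp_backward) auto
    have "norm (integral {\<tau>..b} (\<lambda>s. G v s - G w s))
        \<le> integral {\<tau>..b} (\<lambda>s. L * dist w v * exp (K * (b - s)))"
    proof (rule integral_norm_bound_integral)
      fix s assume "s \<in> {\<tau>..b}"
      then have "s \<in> ?S" using \<tau> by auto
      from lipschitz_onD[OF L[OF this]]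
      have "dist (G v s) (G w s) \<le> L * dist (exp (K * (b - s)) *\<^sub>R apply_bcontfun v s)
          (exp (K * (b - s)) *\<^sub>R apply_bcontfun w s)"
        by (simp add: G_def)
      also have "\<dots> = L * (exp (K * (b - s)) * dist (apply_bcontfun v s) (apply_bcontfun w s))"
        by (simp add: dist_norm flip: scaleR_diff_right)
      also have "\<dots> \<le> L * (exp (K * (b - s)) * dist w v)"
        using L0 dist_bounded[of v s w] by (intro mult_left_mono) (auto simp: dist_commute)
      finally show "norm (G v s - G w s) \<le> L * dist w v * exp (K * (b - s))"
        by (simp add: dist_norm mult_ac)
    qed (use \<tau> intG I in \<open>auto intro!: integrable_diff\<close>)
    also have "\<dots> = L * dist w v * ((exp (K * (b - \<tau>)) - 1) / K)"
      using I by (rule integral_unique)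
    \<comment> \<open>Dropping \<open>- 1\<close> leaves exactly the exponential that the prefactor
      in \<Phi> cancels.\<close>
    also have "\<dots> \<le> L * dist w v * (exp (K * (b - \<tau>)) / K)"
      using K L0 by (intro mult_left_mono divide_right_mono) auto
    finally have bound: "norm (integral {\<tau>..b} (\<lambda>s. G v s - G w s))
        \<le> L * dist w v * (exp (K * (b - \<tau>)) / K)" .
    have "\<Phi> w \<tau> - \<Phi> v \<tau> = exp (- K * (b - \<tau>)) *\<^sub>R integral {\<tau>..b} (\<lambda>s. G v s - G w s)"
      using \<tau> intG by (simp add: \<Phi>_def integral_diff flip: scaleR_diff_right)
    then have "dist (\<Phi> w \<tau>) (\<Phi> v \<tau>)
        = exp (- K * (b - \<tau>)) * norm (integral {\<tau>..b} (\<lambda>s. G v s - G w s))"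
      by (simp add: dist_norm)
    also have "\<dots> \<le> exp (- K * (b - \<tau>)) * (L * dist w v * (exp (K * (b - \<tau>)) / K))"
      using bound by (intro mult_left_mono) auto
    also have "\<dots> = L / K * dist w v"
      by (simp add: exp_minus)
    also have "\<dots> \<le> 1/2 * dist w v"
      using L0 by (intro mult_right_mono) (auto simp: K_def field_simps)
    finally show "dist (apply_bcontfun (A w) t) (apply_bcontfun (A v) t) \<le> 1/2 * dist w v"
      by (simp add: A \<tau>_def)
  qed
  obtain w where w: "A w = w"
    using banach_fix_type[of "1/2" A] contr by auto
  define y where "y t = exp (K * (b - t)) *\<^sub>R apply_bcontfun w t" for t
  have y: "y t = y0 - integral {t..b} (\<lambda>s. F s (y s))" if "t \<in> ?S" for t
  proof -
    have "apply_bcontfun w t = \<Phi> w t" using A[of w t] c(2)[OF that] w by simp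
    moreover have "G w = (\<lambda>s. F s (y s))" by (auto simp: G_def y_def)
    ultimately show ?thesis by (simp add: \<Phi>_def y_def flip: exp_add)
  qed
  have "continuous_on ?S (\<lambda>s. F s (y s))"
    using contG[of w] by (simp add: G_def y_def)
  then have "((\<lambda>t. y0 - integral {t..b} (\<lambda>s. F s (y s))) has_vector_derivative F t (y t))
      (at t within ?S)" if "t \<in> ?S" for t
    using has_vector_derivative_diff[OF has_vector_derivative_const integral_has_vector_derivative'] that
    by fastforce
  then have "(y has_vector_derivative F t (y t)) (at t within ?S)" if "t \<in> ?S" for t
    using that by (rule_tac has_vector_derivative_transform[OF that y]) auto
  moreover have "y b = y0" using y[of b] ab by simp
  ultimately show ?thesis unfolding terminal_value_solution_def by blast
qed

text \<open>Gronwall for the squared distance, which, unlike the norm, is differentiable also where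
  the two solutions meet.\<close>

theorem terminal_value_solution_unique:
  fixes F :: "real \<Rightarrow> 'a::real_inner \<Rightarrow> 'a"
  assumes F: "\<And>R. cont_lipschitz {a..b} (cball 0 R) F"
    and y: "terminal_value_solution {a..b} b F y0 y" and z: "terminal_value_solution {a..b} b F y0 z"
    and t: "t \<in> {a..b}"
  shows "y t = z t"
proof -
  let ?S = "{a..b}"
  \<comment> \<open>The radius depends on the two given solutions, which is why the hypothesis
    ranges over all \<open>R\<close>.\<close>
  have "bounded (y ` ?S \<union> z ` ?S)"
    using y z by (auto intro!: compact_imp_bounded compact_continuous_image
        dest: terminal_value_solution_continuous_on)
  then obtain R where R: "\<And>s. s \<in> ?S \<Longrightarrow> y s \<in> cball 0 R \<and> z s \<in> cball 0 R"
    by (force simp: bounded_iff)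
  obtain L where L: "\<And>s. s \<in> ?S \<Longrightarrow> L-lipschitz_on (cball 0 R) (F s)"
    using F[of R] unfolding cont_lipschitz_def by blast
  \<comment> \<open>The squared distance has derivative at least \<open>- 2 * L\<close> times
    itself, so this factor makes \<open>u\<close> nondecreasing. As \<open>u\<close> is nonnegative
    and vanishes at \<open>b\<close>, it vanishes throughout.\<close>
  define u where "u s = exp (2 * L * s) * ((y s - z s) \<bullet> (y s - z s))" for s
  define u' where "u' s = exp (2 * L * s) *
      (2 * L * ((y s - z s) \<bullet> (y s - z s)) + 2 * ((y s - z s) \<bullet> (F s (y s) - F s (z s))))" for s
  have u': "(u has_real_derivative u' s) (at s within ?S)" if s: "s \<in> ?S" for s
  proof -
    have "((\<lambda>s. y s - z s) has_derivative (\<lambda>h. h *\<^sub>R (F s (y s) - F s (z s)))) (at s within ?S)"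
      using y z s has_vector_derivative_diff unfolding terminal_value_solution_def has_vector_derivative_def
      by (auto intro!: derivative_eq_intros simp: algebra_simps)
    note D = has_derivative_inner[OF this this]
    have "((\<lambda>s. (y s - z s) \<bullet> (y s - z s)) has_real_derivative
        2 * ((y s - z s) \<bullet> (F s (y s) - F s (z s)))) (at s within ?S)"
      unfolding has_field_derivative_def
      by (rule has_derivative_eq_rhs[OF D]) (auto simp: inner_commute)
    moreover have "((\<lambda>s. exp (2 * L * s)) has_real_derivative exp (2 * L * s) * (2 * L))
        (at s within ?S)"
      by (auto intro!: derivative_eq_intros)
    ultimately have "(u has_real_derivative
        exp (2 * L * s) * (2 * L) * ((y s - z s) \<bullet> (y s - z s)) +
        2 * ((y s - z s) \<bullet> (F s (y s) - F s (z s))) * exp (2 * L * s)) (at s within ?S)"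
      unfolding u_def by (rule DERIV_mult[rotated])
    then show ?thesis
      unfolding u'_def by (rule DERIV_cong) (simp only: distrib_left mult_ac)
  qed
  have pos: "u' s \<ge> 0" if s: "s \<in> ?S" for s
  proof -
    have "- ((y s - z s) \<bullet> (F s (y s) - F s (z s))) \<le> norm (y s - z s) * norm (F s (y s) - F s (z s))"
      using Cauchy_Schwarz_ineq2[of "y s - z s" "F s (y s) - F s (z s)"] by linarith
    also have "\<dots> \<le> norm (y s - z s) * (L * norm (y s - z s))"
      using lipschitz_onD[OF L[OF s]] R[OF s] by (intro mult_left_mono) (auto simp: dist_norm)
    also have "\<dots> = L * ((y s - z s) \<bullet> (y s - z s))"
      by (simp add: power2_norm_eq_inner[symmetric] power2_eq_square)
    finally show ?thesis unfolding u'_def by (intro mult_nonneg_nonneg) auto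
  qed
  have "u t \<le> u b"
  proof (rule DERIV_nonneg_imp_increasing_open[where f = u])
    have "continuous_on ?S u" by (rule DERIV_continuous_on[OF u'])
    then show "continuous_on {t..b} u"
      using t by (elim continuous_on_subset) auto
  next
    fix s assume s: "t < s" "s < b"
    with t have "a < s" "s \<in> ?S" by auto
    then show "\<exists>D. (u has_real_derivative D) (at s) \<and> D \<ge> 0"
      using u'[of s] pos[of s] at_within_Icc_at[of a s b] s by metis
  qed (use t in simp)
  also have "u b = 0" using y z by (simp add: u_def terminal_value_solution_def)
  finally have "(y t - z t) \<bullet> (y t - z t) \<le> 0"
    unfolding u_def by (simp only: mult_le_0_iff) (meson exp_gt_zero less_le_not_le)
  then have "y t - z t = 0"
    by (metis inner_gt_zero_iff not_le)
  then show ?thesis by simp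
qed

theorem picard_lindelof_local:
  fixes F :: "real \<Rightarrow> 'a::euclidean_space \<Rightarrow> 'a"
  assumes ab: "a < b" and F: "cont_lipschitz {a..b} (cball y0 1) F"
  shows "\<exists>\<eta>\<in>{0<..b - a}. \<exists>y. terminal_value_solution {b - \<eta>..b} b F y0 y"
proof -
  let ?B = "cball y0 1"
  let ?p = "closest_point ?B"
  have p: "?p y \<in> ?B" "y \<in> ?B \<Longrightarrow> ?p y = y" for y
    by (auto simp: closest_point_self intro!: closest_point_in_set simp del: mem_cball)
  \<comment> \<open>Projection onto a closed convex set is nonexpansive, so the Lipschitz constant
    on the ball survives for the extended field.\<close>
  have lipp: "1-lipschitz_on UNIV ?p"
    by (intro lipschitz_onI) (auto intro!: closest_point_lipschitz)
  obtain L where L: "\<And>t. t \<in> {a..b} \<Longrightarrow> L-lipschitz_on ?B (F t)"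
    using F unfolding cont_lipschitz_def by blast
  have "cont_lipschitz {a..b} UNIV (\<lambda>t y. F t (?p y))"
    unfolding cont_lipschitz_def
  proof (intro conjI exI ballI)
    have "continuous_on ({a..b} \<times> UNIV) ((\<lambda>(t, y). F t y) \<circ> (\<lambda>(t, y). (t, ?p y)))"
      using F p(1) lipschitz_on_continuous_on[OF lipp] unfolding cont_lipschitz_def
      by (intro continuous_on_compose)
        (auto simp: case_prod_unfold intro!: continuous_intros continuous_on_compose2[of UNIV ?p]
          elim!: continuous_on_subset simp del: mem_cball)
    then show "continuous_on ({a..b} \<times> UNIV) (\<lambda>(t, y). F t (?p y))"
      by (simp add: o_def case_prod_unfold)
    fix t assume "t \<in> {a..b}"
    have "(L * 1)-lipschitz_on UNIV (F t \<circ> ?p)"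
      by (rule lipschitz_on_compose[OF lipp lipschitz_on_subset[OF L]]) (use p \<open>t \<in> _\<close> in auto)
    then show "(L * 1)-lipschitz_on UNIV (\<lambda>y. F t (?p y))" by (simp add: o_def)
  qed
  then obtain y where y: "terminal_value_solution {a..b} b (\<lambda>t y. F t (?p y)) y0 y"
    using picard_lindelof_global ab by (meson less_imp_le)
  then have yb: "y b = y0" by (simp add: terminal_value_solution_def)
  have "continuous (at b within {a..b}) y"
    using terminal_value_solution_continuous_on[OF y] ab by (auto simp: continuous_on_eq_continuous_within)
  then obtain d where d: "d > 0" "\<And>t. t \<in> {a..b} \<Longrightarrow> dist t b < d \<Longrightarrow> dist (y t) (y b) < 1"
    unfolding continuous_within_eps_delta by (meson zero_less_one)
  \<comment> \<open>The minimum keeps the short interval inside \<open>{a..b}\<close>, and halving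
    \<open>d\<close> makes the distance to \<open>b\<close> strictly less than \<open>d\<close> at
    its left end point too.\<close>
  define \<eta> where "\<eta> = min (b - a) (d / 2)"
  have \<eta>: "\<eta> \<in> {0<..b - a}" using d ab by (auto simp: \<eta>_def)
  have p_y: "?p (y t) = y t" if "t \<in> {b - \<eta>..b}" for t
  proof -
    have "t \<in> {a..b}" "dist t b < d"
      using that d(1) by (auto simp: \<eta>_def dist_real_def min_def split: if_splits)
    then show ?thesis
      using d(2)[of t] by (intro p(2)) (simp add: yb dist_commute)
  qed
  then have "terminal_value_solution {b - \<eta>..b} b F y0 y"
    unfolding terminal_value_solution_def
  proof (intro conjI ballI)
    fix t assume t: "t \<in> {b - \<eta>..b}"
    with \<eta> have "t \<in> {a..b}" by auto
    with y p_y[OF t] have "(y has_vector_derivative F t (y t)) (at t within {a..b})"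
      unfolding terminal_value_solution_def by metis
    then show "(y has_vector_derivative F t (y t)) (at t within {b - \<eta>..b})"
      using \<eta> by (elim has_vector_derivative_within_subset) auto
  qed (rule yb)
  then show ?thesis using \<eta> by blast
qed

subsection \<open>Closure properties of continuous Lipschitz fields\<close>

text \<open>A function of time alone has Lipschitz constant 0 in the state. This covers the
  coefficients as well as the whole field of the last pair.\<close>

lemma cont_lipschitz_coeff:
  assumes "continuous_on S g"
  shows "cont_lipschitz S Y (\<lambda>t y. g t)"
  unfolding cont_lipschitz_def
  by (auto simp: case_prod_unfold intro!: continuous_on_compose2[OF assms] continuous_intros
      lipschitz_on_constant exI[of _ 0])

lemma cont_lipschitz_fst: "cont_lipschitz S Y (\<lambda>t. fst)"
proof -
  have "1-lipschitz_on Y fst"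
    by (rule lipschitz_onI) (simp_all add: dist_fst_le)
  then show ?thesis
    unfolding cont_lipschitz_def by (auto simp: case_prod_unfold intro!: continuous_intros)
qed

lemma cont_lipschitz_snd: "cont_lipschitz S Y (\<lambda>t. snd)"
proof -
  have "1-lipschitz_on Y snd"
    by (rule lipschitz_onI) (simp_all add: dist_snd_le)
  then show ?thesis
    unfolding cont_lipschitz_def by (auto simp: case_prod_unfold intro!: continuous_intros)
qed

lemma cont_lipschitz_add:
  fixes f g :: "real \<Rightarrow> 'a::metric_space \<Rightarrow> 'b::real_normed_vector"
  assumes "cont_lipschitz S Y f" "cont_lipschitz S Y g"
  shows "cont_lipschitz S Y (\<lambda>t y. f t y + g t y)"
proof -
  from assms obtain L L' where "\<forall>t\<in>S. L-lipschitz_on Y (f t)" "\<forall>t\<in>S. L'-lipschitz_on Y (g t)"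
    by (auto simp: cont_lipschitz_def)
  then have "\<forall>t\<in>S. (L + L')-lipschitz_on Y (\<lambda>y. f t y + g t y)"
    by (auto intro: lipschitz_on_add)
  with assms show ?thesis
    by (auto simp: cont_lipschitz_def case_prod_unfold intro!: continuous_intros)
qed

lemma cont_lipschitz_minus:
  fixes f :: "real \<Rightarrow> 'a::metric_space \<Rightarrow> 'b::real_normed_vector"
  assumes "cont_lipschitz S Y f"
  shows "cont_lipschitz S Y (\<lambda>t y. - f t y)"
  using assms
  by (auto simp: cont_lipschitz_def case_prod_unfold intro!: continuous_intros intro: lipschitz_on_minus)

lemma cont_lipschitz_diff:
  fixes f g :: "real \<Rightarrow> 'a::metric_space \<Rightarrow> 'b::real_normed_vector"
  assumes "cont_lipschitz S Y f" "cont_lipschitz S Y g"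
  shows "cont_lipschitz S Y (\<lambda>t y. f t y - g t y)"
  using cont_lipschitz_add[OF assms(1) cont_lipschitz_minus[OF assms(2)]] by simp

lemma cont_lipschitz_Pair:
  assumes "cont_lipschitz S Y f" "cont_lipschitz S Y g"
  shows "cont_lipschitz S Y (\<lambda>t y. (f t y, g t y))"
proof -
  from assms obtain L L' where "\<forall>t\<in>S. L-lipschitz_on Y (f t)" "\<forall>t\<in>S. L'-lipschitz_on Y (g t)"
    by (auto simp: cont_lipschitz_def)
  then have "\<forall>t\<in>S. (sqrt (L\<^sup>2 + L'\<^sup>2))-lipschitz_on Y (\<lambda>y. (f t y, g t y))"
    by (auto intro: lipschitz_on_Pair)
  with assms show ?thesis
    by (auto simp: cont_lipschitz_def case_prod_unfold intro!: continuous_intros)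
qed

lemma cont_lipschitz_mult_bounded:
  fixes f g :: "real \<Rightarrow> 'a::metric_space \<Rightarrow> real"
  assumes f: "cont_lipschitz S Y f" and g: "cont_lipschitz S Y g"
    and A: "\<And>t y. t \<in> S \<Longrightarrow> y \<in> Y \<Longrightarrow> \<bar>f t y\<bar> \<le> A"
    and B: "\<And>t y. t \<in> S \<Longrightarrow> y \<in> Y \<Longrightarrow> \<bar>g t y\<bar> \<le> B"
  shows "cont_lipschitz S Y (\<lambda>t y. f t y * g t y)"
proof -
  from f g obtain L L' where "\<forall>t\<in>S. L-lipschitz_on Y (f t)" "\<forall>t\<in>S. L'-lipschitz_on Y (g t)"
    by (auto simp: cont_lipschitz_def)
  \<comment> \<open>Absolute values keep the final constant nonnegative without case distinctions;
    \<open>A\<close>, for instance, may be negative when \<open>Y\<close> is empty.\<close>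
  then have L: "\<bar>L\<bar>-lipschitz_on Y (f t)" "\<bar>L'\<bar>-lipschitz_on Y (g t)" if "t \<in> S" for t
    using that by (auto intro: lipschitz_on_le)
  have "(\<bar>A\<bar> * \<bar>L'\<bar> + \<bar>B\<bar> * \<bar>L\<bar>)-lipschitz_on Y (\<lambda>y. f t y * g t y)" if t: "t \<in> S" for t
  proof (rule lipschitz_onI)
    fix y z assume yz: "y \<in> Y" "z \<in> Y"
    have "\<bar>f t y * g t y - f t z * g t z\<bar> = \<bar>f t y * (g t y - g t z) + g t z * (f t y - f t z)\<bar>"
      by (simp add: algebra_simps)
    also have "\<dots> \<le> \<bar>f t y\<bar> * \<bar>g t y - g t z\<bar> + \<bar>g t z\<bar> * \<bar>f t y - f t z\<bar>"
      by (metis abs_mult abs_triangle_ineq)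
    also have "\<dots> \<le> \<bar>A\<bar> * (\<bar>L'\<bar> * dist y z) + \<bar>B\<bar> * (\<bar>L\<bar> * dist y z)"
      using A[OF t yz(1)] B[OF t yz(2)] lipschitz_onD[OF L(1)[OF t] yz] lipschitz_onD[OF L(2)[OF t] yz]
      by (intro add_mono mult_mono) (auto simp: dist_real_def)
    finally show "dist (f t y * g t y) (f t z * g t z) \<le> (\<bar>A\<bar> * \<bar>L'\<bar> + \<bar>B\<bar> * \<bar>L\<bar>) * dist y z"
      by (simp add: dist_real_def algebra_simps)
  qed auto
  with f g show ?thesis
    by (auto simp: cont_lipschitz_def case_prod_unfold intro!: continuous_intros)
qed

lemma cont_lipschitz_bounded:
  fixes f :: "real \<Rightarrow> 'a::metric_space \<Rightarrow> real"
  assumes "compact S" "compact Y" "cont_lipschitz S Y f"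
  shows "\<exists>A. \<forall>t\<in>S. \<forall>y\<in>Y. \<bar>f t y\<bar> \<le> A"
proof -
  have "bounded ((\<lambda>(t, y). f t y) ` (S \<times> Y))"
    using assms unfolding cont_lipschitz_def
    by (intro compact_imp_bounded compact_continuous_image compact_Times) auto
  then obtain A where "\<forall>x\<in>(\<lambda>(t, y). f t y) ` (S \<times> Y). \<bar>x\<bar> \<le> A"
    by (auto simp: bounded_iff)
  then show ?thesis by force
qed

text \<open>Compactness supplies the bounds on both factors. This is the product rule for the
  quadratic field, on closed balls.\<close>

lemma cont_lipschitz_mult:
  fixes f g :: "real \<Rightarrow> 'a::metric_space \<Rightarrow> real"
  assumes "compact S" "compact Y" "cont_lipschitz S Y f" "cont_lipschitz S Y g"
  shows "cont_lipschitz S Y (\<lambda>t y. f t y * g t y)"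
proof -
  obtain A where "\<And>t y. t \<in> S \<Longrightarrow> y \<in> Y \<Longrightarrow> \<bar>f t y\<bar> \<le> A"
    using cont_lipschitz_bounded[OF assms(1-3)] by blast
  moreover obtain B where "\<And>t y. t \<in> S \<Longrightarrow> y \<in> Y \<Longrightarrow> \<bar>g t y\<bar> \<le> B"
    using cont_lipschitz_bounded[OF assms(1,2,4)] by blast
  ultimately show ?thesis
    by (rule cont_lipschitz_mult_bounded[OF assms(3,4)])
qed

text \<open>Since one factor is independent of the state, a bound on that factor suffices and
  \<open>Y\<close> may be the whole space. Global existence for the affine pair rests on
  this.\<close>

lemma cont_lipschitz_coeff_mult:
  fixes g :: "real \<Rightarrow> 'a::metric_space \<Rightarrow> real"
  assumes "compact S" "continuous_on S c" "cont_lipschitz S Y g"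
  shows "cont_lipschitz S Y (\<lambda>t y. c t * g t y)"
proof -
  have "bounded (c ` S)"
    using assms by (intro compact_imp_bounded compact_continuous_image)
  then obtain A where A: "\<And>t. t \<in> S \<Longrightarrow> \<bar>c t\<bar> \<le> A" by (auto simp: bounded_iff)
  from assms obtain L where "\<forall>t\<in>S. L-lipschitz_on Y (g t)" by (auto simp: cont_lipschitz_def)
  then have L: "\<bar>L\<bar>-lipschitz_on Y (g t)" if "t \<in> S" for t
    using that by (auto intro: lipschitz_on_le)
  have "(\<bar>A\<bar> * \<bar>L\<bar>)-lipschitz_on Y (\<lambda>y. c t * g t y)" if t: "t \<in> S" for t
  proof (rule lipschitz_onI)
    fix y z assume yz: "y \<in> Y" "z \<in> Y"
    have "\<bar>c t\<bar> * \<bar>g t y - g t z\<bar> \<le> \<bar>A\<bar> * (\<bar>L\<bar> * dist y z)"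
      using A[OF t] lipschitz_onD[OF L[OF t] yz] by (intro mult_mono) (auto simp: dist_real_def)
    then show "dist (c t * g t y) (c t * g t z) \<le> \<bar>A\<bar> * \<bar>L\<bar> * dist y z"
      by (metis dist_real_def abs_mult right_diff_distrib mult.assoc)
  qed auto
  moreover have "continuous_on (S \<times> Y) (\<lambda>(t, y). c t)"
    using cont_lipschitz_coeff[OF assms(2)] by (auto simp: cont_lipschitz_def)
  ultimately show ?thesis using assms(3)
    by (auto simp: cont_lipschitz_def case_prod_unfold intro!: continuous_intros)
qed

lemma cont_lipschitz_mult_coeff:
  fixes g :: "real \<Rightarrow> 'a::metric_space \<Rightarrow> real"
  assumes "compact S" "cont_lipschitz S Y g" "continuous_on S c"
  shows "cont_lipschitz S Y (\<lambda>t y. g t y * c t)"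
  using cont_lipschitz_coeff_mult[OF assms(1,3,2)] by (simp add: mult.commute)

subsection \<open>The Riccati system\<close>

text \<open>Passes between the scalar formulation of the statement and the vector formulation. From
  right to left, continuity of the derivatives comes from the equation itself, as the field is
  continuous along the solution.\<close>

lemma C1_solution_pair_iff:
  assumes F: "\<And>R. cont_lipschitz {a..b} (cball 0 R) F"
  shows "f b = 0 \<and> g b = 0 \<and>
      (\<exists>df dg. has_C1_derivative_on f df {a..b} \<and> has_C1_derivative_on g dg {a..b} \<and>
        (\<forall>t\<in>{a..b}. df t = fst (F t (f t, g t)) \<and> dg t = snd (F t (f t, g t))))
    \<longleftrightarrow> terminal_value_solution {a..b} b F 0 (\<lambda>t. (f t, g t))" (is "?L \<longleftrightarrow> ?R")
proof
  assume ?L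
  then obtain df dg where *: "f b = 0" "g b = 0"
    "has_C1_derivative_on f df {a..b}" "has_C1_derivative_on g dg {a..b}"
    "\<And>t. t \<in> {a..b} \<Longrightarrow> (df t, dg t) = F t (f t, g t)"
    by (auto simp: prod_eq_iff)
  have "((\<lambda>t. (f t, g t)) has_vector_derivative F t (f t, g t)) (at t within {a..b})"
    if t: "t \<in> {a..b}" for t
    unfolding *(5)[OF t, symmetric] using *(3,4) t
    by (intro has_vector_derivative_Pair)
      (auto simp: has_C1_derivative_on_def has_real_derivative_iff_has_vector_derivative)
  then show ?R using *(1,2) by (simp add: terminal_value_solution_def zero_prod_def)
next
  let ?y = "\<lambda>t. (f t, g t)"
  assume R: ?R
  then have cont: "continuous_on {a..b} ?y" by (rule terminal_value_solution_continuous_on)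
  \<comment> \<open>The field is known to be continuous only on bounded state sets, so the
    trajectory is first enclosed in a ball.\<close>
  then have "bounded (?y ` {a..b})"
    by (intro compact_imp_bounded compact_continuous_image) auto
  then obtain r where r: "?y ` {a..b} \<subseteq> ball 0 r"
    using bounded_subset_ballD by blast
  have contF: "continuous_on {a..b} (\<lambda>t. F t (?y t))"
  proof (rule continuous_on_field_compose[where F = F and y = ?y])
    show "continuous_on ({a..b} \<times> cball 0 r) (\<lambda>(t, y). F t y)"
      using F[of r] unfolding cont_lipschitz_def by (rule conjunct1)
    show "?y ` {a..b} \<subseteq> cball 0 r"
      using r ball_subset_cball by (rule order_trans)
  qed (rule cont)
  have D: "(?y has_vector_derivative F t (?y t)) (at t within {a..b})" if "t \<in> {a..b}" for t
    using R that by (simp add: terminal_value_solution_def)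
  have D1: "(f has_real_derivative fst (F t (?y t))) (at t within {a..b})" if "t \<in> {a..b}" for t
    using bounded_linear.has_vector_derivative[OF bounded_linear_fst D[OF that]]
    by (simp add: has_real_derivative_iff_has_vector_derivative)
  have D2: "(g has_real_derivative snd (F t (?y t))) (at t within {a..b})" if "t \<in> {a..b}" for t
    using bounded_linear.has_vector_derivative[OF bounded_linear_snd D[OF that]]
    by (simp add: has_real_derivative_iff_has_vector_derivative)
  have "has_C1_derivative_on f (\<lambda>t. fst (F t (?y t))) {a..b}"
    "has_C1_derivative_on g (\<lambda>t. snd (F t (?y t))) {a..b}"
    unfolding has_C1_derivative_on_def using D1 D2 contF by (auto intro!: continuous_intros)
  then show ?L using R by (auto simp: terminal_value_solution_def zero_prod_def)
qed

text \<open>Common last step for all three pairs: with the equations in normal form, any one vector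
  solution yields existence, and the Gronwall theorem yields uniqueness.\<close>

lemma unique_solution_onI:
  assumes F: "\<And>R. cont_lipschitz {a..b} (cball 0 R) F"
    and solves: "\<And>f g. solves f g \<longleftrightarrow> f b = 0 \<and> g b = 0 \<and>
      (\<exists>df dg. has_C1_derivative_on f df {a..b} \<and> has_C1_derivative_on g dg {a..b} \<and>
        (\<forall>t\<in>{a..b}. df t = fst (F t (f t, g t)) \<and> dg t = snd (F t (f t, g t))))"
    and y: "terminal_value_solution {a..b} b F 0 y"
  shows "unique_solution_on {a..b} solves (\<lambda>t. fst (y t)) (\<lambda>t. snd (y t))"
proof -
  have iff: "solves f g \<longleftrightarrow> terminal_value_solution {a..b} b F 0 (\<lambda>t. (f t, g t))" for f g
    unfolding solves using F by (rule C1_solution_pair_iff)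
  have "f t = fst (y t) \<and> g t = snd (y t)" if "solves f g" "t \<in> {a..b}" for f g t
  proof -
    have "(f t, g t) = y t"
      using that by (intro terminal_value_solution_unique[OF F _ y]) (simp_all only: iff)
    then show ?thesis by (metis fst_conv snd_conv)
  qed
  then show ?thesis
    unfolding unique_solution_on_def using y by (simp add: iff)
qed

section \<open>The three pairs as vector fields in the plane\<close>

definition field2 :: "model \<Rightarrow> real \<Rightarrow> real \<times> real \<Rightarrow> real \<times> real" where
  "field2 M t y =
     (- (2 * fst y * ric_a M t (fst y) (snd y)
        + exp (- rate M * t) / 2 * ric_e1 M t (fst y) (snd y) * ric_c M t (fst y) (snd y)
        - ert M t * (delta M t)\<^sup>2 * (fst y)\<^sup>2),
      - (2 * snd y * ric_a M t (fst y) (snd y)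
        + exp (- rate M * t) / 2 * ric_h1 M t (fst y) (snd y) * ric_c M t (fst y) (snd y)
        - ert M t * (delta M t)\<^sup>2 * (snd y)\<^sup>2))"

definition field1 :: "model \<Rightarrow> (real \<Rightarrow> real) \<Rightarrow> (real \<Rightarrow> real) \<Rightarrow> real \<Rightarrow> real \<times> real \<Rightarrow> real \<times> real"
  where
  "field1 M P2 N2 t y =
     (- (2 * P2 t * ric_b M t (P2 t) (N2 t) (fst y) (snd y) + fst y * ric_a M t (P2 t) (N2 t)
        + P2 t * (ric_a M t (P2 t) (N2 t) + 2 * beta_x M)
        + exp (- rate M * t) / 2 *
          (ric_e1 M t (P2 t) (N2 t) * ric_d M t (P2 t) (N2 t) (fst y) (snd y)
           + ric_e0 M t (P2 t) (N2 t) (fst y) (snd y) * ric_c M t (P2 t) (N2 t))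
        - ert M t * (delta M t)\<^sup>2 * P2 t * (fst y + P2 t)),
      - (2 * N2 t * ric_b M t (P2 t) (N2 t) (fst y) (snd y) + snd y * ric_a M t (P2 t) (N2 t)
        + N2 t * (ric_a M t (P2 t) (N2 t) + 2 * beta_x M)
        + exp (- rate M * t) / 2 *
          (ric_h1 M t (P2 t) (N2 t) * ric_d M t (P2 t) (N2 t) (fst y) (snd y)
           + ric_h0 M t (P2 t) (N2 t) (fst y) (snd y) * ric_c M t (P2 t) (N2 t))
        - ert M t * (delta M t)\<^sup>2 * N2 t * (snd y + N2 t)))"

text \<open>There is no state argument, because the equations of the last pair contain their
  unknowns only through the derivatives.\<close>

definition field0 :: "model \<Rightarrow> (real \<Rightarrow> real) \<Rightarrow> (real \<Rightarrow> real) \<Rightarrow> (real \<Rightarrow> real) \<Rightarrow> (real \<Rightarrow> real)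
    \<Rightarrow> real \<Rightarrow> real \<times> real" where
  "field0 M P2 N2 P1 N1 t =
    (let b = ric_b M t (P2 t) (N2 t) (P1 t) (N1 t);
         d = ric_d M t (P2 t) (N2 t) (P1 t) (N1 t);
         e0 = ric_e0 M t (P2 t) (N2 t) (P1 t) (N1 t);
         h0 = ric_h0 M t (P2 t) (N2 t) (P1 t) (N1 t)
     in
       (- ((P1 t + P2 t) * b + exp (- rate M * t) / 2 * e0 * d
          - ert M t * (delta M t)\<^sup>2 / 4 * (P1 t + P2 t)\<^sup>2),
        - ((N1 t + N2 t) * b + exp (- rate M * t) / 2 * h0 * d
          - ert M t * (delta M t)\<^sup>2 / 4 * (N1 t + N2 t)\<^sup>2)))"

text \<open>The two shapes match the number of summands in the equations, so that rewriting turns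
  the definitions literally into the normal form and reflexivity closes the next three
  proofs.\<close>

lemma solve_for_derivative:
  fixes x :: real
  shows solve_for_derivative3: "x + a + b - c = 0 \<longleftrightarrow> x = - (a + b - c)"
    and solve_for_derivative5: "x + a + b + d + e - c = 0 \<longleftrightarrow> x = - (a + b + d + e - c)"
  by linarith+

lemma solves_P2_N2_iff:
  "solves_P2_N2 M T \<eta> P N \<longleftrightarrow> P T = 0 \<and> N T = 0 \<and>
     (\<exists>dP dN. has_C1_derivative_on P dP {T - \<eta>..T} \<and> has_C1_derivative_on N dN {T - \<eta>..T} \<and>
       (\<forall>t\<in>{T - \<eta>..T}. dP t = fst (field2 M t (P t, N t)) \<and> dN t = snd (field2 M t (P t, N t))))"
  unfolding solves_P2_N2_def field2_def Let_def solve_for_derivative3 fst_conv snd_conv by (rule refl)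

lemma solves_P1_N1_iff:
  "solves_P1_N1 M T \<eta> P2 N2 P N \<longleftrightarrow> P T = 0 \<and> N T = 0 \<and>
     (\<exists>dP dN. has_C1_derivative_on P dP {T - \<eta>..T} \<and> has_C1_derivative_on N dN {T - \<eta>..T} \<and>
       (\<forall>t\<in>{T - \<eta>..T}. dP t = fst (field1 M P2 N2 t (P t, N t))
         \<and> dN t = snd (field1 M P2 N2 t (P t, N t))))"
  unfolding solves_P1_N1_def field1_def Let_def solve_for_derivative5 fst_conv snd_conv by (rule refl)

lemma solves_P0_N0_iff:
  "solves_P0_N0 M T \<eta> P2 N2 P1 N1 P N \<longleftrightarrow> P T = 0 \<and> N T = 0 \<and>
     (\<exists>dP dN. has_C1_derivative_on P dP {T - \<eta>..T} \<and> has_C1_derivative_on N dN {T - \<eta>..T} \<and>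
       (\<forall>t\<in>{T - \<eta>..T}. dP t = fst (field0 M P2 N2 P1 N1 t)
         \<and> dN t = snd (field0 M P2 N2 P1 N1 t)))"
  unfolding solves_P0_N0_def field0_def Let_def solve_for_derivative3 fst_conv snd_conv by (rule refl)

text \<open>The time set is left open because the facts are used twice: on the full interval to find
  the local solution, then on the short interval. Positivity keeps the denominators of the
  coefficients away from zero.\<close>

locale continuous_model =
  fixes M :: model and S :: "real set"
  assumes continuous: "continuous_on S (beta_p M)" "continuous_on S (beta_w M)"
      "continuous_on S (delta M)"
    and pos: "gamma_p M > 0" "gamma_w M > 0"
    and compact: "compact S"
begin

lemma continuous_on_ert: "continuous_on S (ert M)"
  unfolding ert_def by (intro continuous_intros)

lemma denominator_nonzero:
  "gamma_p M * (2 * gamma_w M + gamma_p M) \<noteq> 0" "2 * gamma_w M \<noteq> 0"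
  using pos by simp_all

lemma continuous_on_K1: "continuous_on S (K1 M)"
  and continuous_on_K2: "continuous_on S (K2 M)"
  unfolding K1_def K2_def
  using denominator_nonzero by (auto intro!: continuous_intros continuous continuous_on_ert)

lemma continuous_on_K:
  "continuous_on S (K5 M)" "continuous_on S (K6 M)" "continuous_on S (K9 M)"
  "continuous_on S (K10 M)" "continuous_on S (K11 M)" "continuous_on S (K12 M)"
  "continuous_on S (K13 M)" "continuous_on S (K16 M)"
  unfolding K5_def K6_def K9_def K10_def K11_def K12_def K13_def K16_def
  using denominator_nonzero
  by (auto intro!: continuous_intros continuous continuous_on_ert continuous_on_K1 continuous_on_K2)

lemmas continuous_coeffs = continuous continuous_on_ert continuous_on_K1 continuous_on_K2 continuous_on_K

lemmas ric_defs = ric_a_def ric_b_def ric_c_def ric_d_def ric_e1_def ric_e0_def ric_h1_def ric_h0_def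

text \<open>Stated for the quotient as it occurs in the fields, since
  \<open>continuous_on_rules\<close> has no rule for division.\<close>

lemma continuous_on_exp_rate: "continuous_on S (\<lambda>t. exp (- rate M * t) / 2)"
  by (intro continuous_intros) simp

lemmas continuous_on_rules = continuous_on_exp_rate continuous_coeffs continuous_on_const
  continuous_on_mult continuous_on_add continuous_on_diff continuous_on_minus

text \<open>The order of the rules in the next two proofs matters: the rule for coefficients comes first,
  so that the product rules only see products that depend on the unknowns.\<close>

lemma cont_lipschitz_field2: "cont_lipschitz S (cball 0 R) (field2 M)"
  unfolding field2_def ric_defs power2_eq_square
  by (rule cont_lipschitz_coeff cont_lipschitz_fst cont_lipschitz_snd cont_lipschitz_Pair
      cont_lipschitz_minus cont_lipschitz_add cont_lipschitz_diff
      cont_lipschitz_mult[OF compact compact_cball] continuous_on_rules)+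

lemma cont_lipschitz_field1:
  assumes "continuous_on S P2" "continuous_on S N2"
  shows "cont_lipschitz S Y (field1 M P2 N2)"
  unfolding field1_def ric_defs power2_eq_square
  by (rule cont_lipschitz_coeff cont_lipschitz_fst cont_lipschitz_snd cont_lipschitz_Pair
      cont_lipschitz_minus cont_lipschitz_add cont_lipschitz_diff
      cont_lipschitz_coeff_mult[OF compact] cont_lipschitz_mult_coeff[OF compact]
      continuous_on_rules assms)+

lemma continuous_on_field0:
  assumes "continuous_on S P2" "continuous_on S N2" "continuous_on S P1" "continuous_on S N1"
  shows "continuous_on S (field0 M P2 N2 P1 N1)"
  unfolding field0_def ric_defs power2_eq_square Let_def
  by (rule continuous_on_rules continuous_on_Pair continuous_on_divide assms | simp)+

end

lemma continuous_model_subset: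
  "continuous_model M S \<Longrightarrow> S' \<subseteq> S \<Longrightarrow> compact S' \<Longrightarrow> continuous_model M S'"
  unfolding continuous_model_def by (auto elim: continuous_on_subset)

theorem mainTheorem3:
  fixes M :: model and T :: real
  assumes "T > 0"
    and "continuous_on {0..T} (beta_p M)" and "\<forall>t\<in>{0..T}. beta_p M t > 0"
    and "continuous_on {0..T} (beta_w M)" and "\<forall>t\<in>{0..T}. beta_w M t > 0"
    and "continuous_on {0..T} (delta M)" and "\<forall>t\<in>{0..T}. delta M t > 0"
    and "beta_x M > 0" and "alpha M > 0"
    and "gamma_p M > 0" and "gamma_w M > 0" and "gamma_x M > 0"
    and "rate M > 0"
  shows "\<exists>\<eta>\<in>{0<..T}. \<exists>P2 N2.
    unique_solution_on {T - \<eta>..T} (solves_P2_N2 M T \<eta>) P2 N2 \<and>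
    (\<exists>P1 N1.
      unique_solution_on {T - \<eta>..T} (solves_P1_N1 M T \<eta> P2 N2) P1 N1 \<and>
      (\<exists>P0 N0.
        unique_solution_on {T - \<eta>..T} (solves_P0_N0 M T \<eta> P2 N2 P1 N1) P0 N0))"
proof -
  have M: "continuous_model M {0..T}"
    using assms by (simp add: continuous_model_def)
  \<comment> \<open>The length of the interval is fixed here by the quadratic pair alone; the other
    two pairs do not shrink it.\<close>
  obtain \<eta> y2 where \<eta>: "\<eta> \<in> {0<..T}" and y2: "terminal_value_solution {T - \<eta>..T} T (field2 M) 0 y2"
    using picard_lindelof_local[OF \<open>T > 0\<close> continuous_model.cont_lipschitz_field2[OF M]] by auto
  let ?S = "{T - \<eta>..T}"
  interpret continuous_model M ?S
    using \<eta> by (intro continuous_model_subset[OF M]) auto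
  have S: "T - \<eta> \<le> T" using \<eta> by simp
  define P2 N2 where "P2 t = fst (y2 t)" and "N2 t = snd (y2 t)" for t
  have cont2: "continuous_on ?S P2" "continuous_on ?S N2"
    unfolding P2_def N2_def using terminal_value_solution_continuous_on[OF y2]
    by (intro continuous_intros; assumption)+
  have u2: "unique_solution_on ?S (solves_P2_N2 M T \<eta>) P2 N2"
    unfolding P2_def N2_def
    using cont_lipschitz_field2 solves_P2_N2_iff y2 by (rule unique_solution_onI)
  \<comment> \<open>Once \<open>P2\<close> and \<open>N2\<close> are fixed continuous functions, the
    field is affine in the state, so the global theorem applies on all of \<open>?S\<close>.\<close>
  obtain y1 where y1: "terminal_value_solution ?S T (field1 M P2 N2) 0 y1"
    using picard_lindelof_global[OF S cont_lipschitz_field1[OF cont2]] by blast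
  define P1 N1 where "P1 t = fst (y1 t)" and "N1 t = snd (y1 t)" for t
  have cont1: "continuous_on ?S P1" "continuous_on ?S N1"
    unfolding P1_def N1_def using terminal_value_solution_continuous_on[OF y1]
    by (intro continuous_intros; assumption)+
  have u1: "unique_solution_on ?S (solves_P1_N1 M T \<eta> P2 N2) P1 N1"
    unfolding P1_def N1_def
    using cont_lipschitz_field1[OF cont2] solves_P1_N1_iff y1 by (rule unique_solution_onI)
  \<comment> \<open>The state set stays schematic: the whole space is taken for existence, balls for
    uniqueness.\<close>
  note F0 = cont_lipschitz_coeff[OF continuous_on_field0[OF cont2 cont1]]
  obtain y0 where y0: "terminal_value_solution ?S T (\<lambda>t y. field0 M P2 N2 P1 N1 t) 0 y0"
    using picard_lindelof_global[OF S F0] by blast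
  have u0: "unique_solution_on ?S (solves_P0_N0 M T \<eta> P2 N2 P1 N1)
      (\<lambda>t. fst (y0 t)) (\<lambda>t. snd (y0 t))"
    using F0 solves_P0_N0_iff y0 by (rule unique_solution_onI)
  show ?thesis using \<eta> u2 u1 u0 by blast
qed

end
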